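(* Consider $m\ge 1$ independent events with bettor probabilities $p_{\ell i}$ and state prices $\pi_{\ell i}$ ($1\le \ell\le m$, $i\in\Omega_\ell=\{1,\dots,n_\ell\}$). For each $\ell$ let $(c_\ell^*,s_\ell^* )$, with $s_\ell^*=(s_{\ell 1}^*,\dots,s_{\ell n_\ell}^* )$, be the unique optimal solution of the one-event Kelly problem for event $\ell$, and assume that each one-event Kelly problem has positive cash, i.e. $c_\ell^*>0$ for all $\ell$. Put $$F_\ell(i):=c_\ell^*+\frac{s_{\ell i}^*}{\pi_{\ell i}}\qquad(i\in\Omega_\ell),$$ and for every ticket $\gamma\in\Gamma$ define $$x_\gamma^*:=\prod_{\ell:\,\gamma_\ell=0}c_\ell^*\ \prod_{\ell:\,\gamma_\ell\ne 0}s_{\ell,\gamma_\ell}^*.$$ Then $x^*=(x^*_\gamma)_{\gamma\in\Gamma}$ is feasible and optimal for the simultaneous multibet Kelly problem, i.e. it attains the supremum $V_{\mathrm{par}}$. Its terminal wealth factorizes as $$W_{x^*}(I)=\prod_{\ell=1}^m F_\ell(I_\ell)$$ for every outcome vector $I=(I_1,\dots,I_m)$, and therefore $$V_{\mathrm{par}}=\sum_{\ell=1}^m \mathbb{E}[\log F_\ell(I_\ell)].$$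
   Context: Events. Event $\ell$ has finite outcome set $\Omega_\ell=\{1,\dots,n_\ell\}$, probabilities $p_{\ell i}>0$ with $\sum_{i}p_{\ell i}=1$, and state prices $\pi_{\ell i}>0$. The realized outcomes $I_1,\dots,I_m$ are independent with $P(I_\ell=i)=p_{\ell i}$; $I=(I_1,\dots,I_m)$. Expectations are with respect to this law, and $\log 0=-\infty$. One-event Kelly problem for event $\ell$: maximize $\sum_{i=1}^{n_\ell}p_{\ell i}\log\left(c+\frac{s_i}{\pi_{\ell i}}\right)$ over $c\ge 0$, $s_i\ge 0$ subject to $c+\sum_{i=1}^{n_\ell}s_i=1$. Here $c$ is the cash level and $s_i$ is the stake on outcome $i$. Tickets. A ticket is a vector $\gamma=(\gamma_1,\dots,\gamma_m)$ with $\gamma_\ell\in\{0\}\cup\Omega_\ell$, where $\gamma_\ell=0$ means the ticket omits event $\ell$. $\Gamma$ is the set of all tickets. The (multiplicative) price of $\gamma$ is $\pi_\gamma:=\prod_{\ell:\gamma_\ell\ne0}\pi_{\ell,\gamma_\ell}$ (empty product $=1$). Write $\gamma\preceq I$ if $\gamma_\ell=I_\ell$ for all $\ell$ with $\gamma_\ell\neq0$. Simultaneous multibet Kelly problem. A stake vector $x=(x_\gamma)_{\gamma\in\Gamma}$ is feasible if $x_\gamma\ge0$ for all $\gamma$ and $\sum_{\gamma\in\Gamma}x_\gamma=1$. Its terminal wealth is $W_x(I)=\sum_{\gamma\preceq I}x_\gamma/\pi_\gamma$. Set $V_{\mathrm{par}}:=\sup_x\mathbb{E}[\log W_x(I)]$,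 the supremum over feasible $x$. *)

theory Defs
  imports "HOL-Probability.Probability"
begin

text \<open>
  Events are indexed by \<open>1..m\<close>, and event \<open>l\<close> has outcomes \<open>1..n l\<close>.  The probabilities of
  event \<open>l\<close> are given by a pmf \<open>p l\<close> with support exactly \<open>{1..n l}\<close>; this says that they are
  positive there and sum to one.  The state price of outcome \<open>i\<close> of event \<open>l\<close> is \<open>\<pi> l i\<close>.
\<close>

definition outcomes :: "(nat \<Rightarrow> nat) \<Rightarrow> nat \<Rightarrow> nat set" where
  "outcomes n l = {1..n l}"

text \<open>The real \<open>ln\<close> satisfies \<open>ln 0 = 0\<close>, whereas here \<open>log 0\<close> must be minus infinity.\<close>

definition elog :: "real \<Rightarrow> ereal" where
  "elog w = (if 0 < w then ereal (ln w) else - \<infinity>)"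

text \<open>
  Expectation of an extended-real function under a law with finite support.  It is only applied
  to functions that never take the value \<open>\<infinity>\<close>.
\<close>

definition expect :: "'a pmf \<Rightarrow> ('a \<Rightarrow> ereal) \<Rightarrow> ereal" where
  "expect P f = (\<Sum>x\<in>set_pmf P. ereal (pmf P x) * f x)"

text \<open>The joint law of the independent outcomes; outcome vectors are \<open>0\<close> outside \<open>{1..m}\<close>.\<close>

definition outcome_law :: "nat \<Rightarrow> (nat \<Rightarrow> nat pmf) \<Rightarrow> (nat \<Rightarrow> nat) pmf" where
  "outcome_law m p = Pi_pmf {1..m} 0 p"


subsection \<open>The one-event Kelly problem\<close>

text \<open>Here \<open>A\<close> is the outcome set, \<open>q\<close> the outcome law and \<open>r\<close> the state prices of the event.\<close>

definition kelly_feasible :: "nat set \<Rightarrow> real \<Rightarrow> (nat \<Rightarrow> real) \<Rightarrow> bool" where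
  "kelly_feasible A c s \<longleftrightarrow> 0 \<le> c \<and> (\<forall>i\<in>A. 0 \<le> s i) \<and> c + (\<Sum>i\<in>A. s i) = 1"

definition kelly_objective ::
  "nat set \<Rightarrow> nat pmf \<Rightarrow> (nat \<Rightarrow> real) \<Rightarrow> real \<Rightarrow> (nat \<Rightarrow> real) \<Rightarrow> ereal" where
  "kelly_objective A q r c s = (\<Sum>i\<in>A. ereal (pmf q i) * elog (c + s i / r i))"

definition kelly_optimal ::
  "nat set \<Rightarrow> nat pmf \<Rightarrow> (nat \<Rightarrow> real) \<Rightarrow> real \<Rightarrow> (nat \<Rightarrow> real) \<Rightarrow> bool" where
  "kelly_optimal A q r c s \<longleftrightarrow> kelly_feasible A c s \<and>
     (\<forall>c' s'. kelly_feasible A c' s' \<longrightarrow> kelly_objective A q r c' s' \<le> kelly_objective A q r c s)"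

text \<open>Stakes are functions on all of \<open>nat\<close>, so uniqueness is up to their values outside \<open>A\<close>.\<close>

definition kelly_unique_optimal ::
  "nat set \<Rightarrow> nat pmf \<Rightarrow> (nat \<Rightarrow> real) \<Rightarrow> real \<Rightarrow> (nat \<Rightarrow> real) \<Rightarrow> bool" where
  "kelly_unique_optimal A q r c s \<longleftrightarrow> kelly_optimal A q r c s \<and>
     (\<forall>c' s'. kelly_optimal A q r c' s' \<longrightarrow> c' = c \<and> (\<forall>i\<in>A. s' i = s i))"


subsection \<open>The simultaneous multibet Kelly problem\<close>

text \<open>A ticket takes the value \<open>0\<close> at the events it omits.\<close>

definition tickets :: "nat \<Rightarrow> (nat \<Rightarrow> nat) \<Rightarrow> (nat \<Rightarrow> nat) set" where
  "tickets m n = (\<Pi>\<^sub>E l\<in>{1..m}. {0} \<union> outcomes n l)"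

definition ticket_price :: "nat \<Rightarrow> (nat \<Rightarrow> nat \<Rightarrow> real) \<Rightarrow> (nat \<Rightarrow> nat) \<Rightarrow> real" where
  "ticket_price m \<pi> \<gamma> = (\<Prod>l\<in>{l\<in>{1..m}. \<gamma> l \<noteq> 0}. \<pi> l (\<gamma> l))"

definition ticket_wins :: "nat \<Rightarrow> (nat \<Rightarrow> nat) \<Rightarrow> (nat \<Rightarrow> nat) \<Rightarrow> bool" where
  "ticket_wins m \<gamma> I \<longleftrightarrow> (\<forall>l\<in>{1..m}. \<gamma> l \<noteq> 0 \<longrightarrow> \<gamma> l = I l)"

definition multibet_feasible :: "nat \<Rightarrow> (nat \<Rightarrow> nat) \<Rightarrow> ((nat \<Rightarrow> nat) \<Rightarrow> real) \<Rightarrow> bool" where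
  "multibet_feasible m n x \<longleftrightarrow> (\<forall>\<gamma>\<in>tickets m n. 0 \<le> x \<gamma>) \<and> (\<Sum>\<gamma>\<in>tickets m n. x \<gamma>) = 1"

definition wealth ::
  "nat \<Rightarrow> (nat \<Rightarrow> nat) \<Rightarrow> (nat \<Rightarrow> nat \<Rightarrow> real) \<Rightarrow> ((nat \<Rightarrow> nat) \<Rightarrow> real) \<Rightarrow> (nat \<Rightarrow> nat) \<Rightarrow> real" where
  "wealth m n \<pi> x I = (\<Sum>\<gamma>\<in>{\<gamma>\<in>tickets m n. ticket_wins m \<gamma> I}. x \<gamma> / ticket_price m \<pi> \<gamma>)"

definition growth ::
  "nat \<Rightarrow> (nat \<Rightarrow> nat) \<Rightarrow> (nat \<Rightarrow> nat pmf) \<Rightarrow> (nat \<Rightarrow> nat \<Rightarrow> real) \<Rightarrow> ((nat \<Rightarrow> nat) \<Rightarrow> real) \<Rightarrow> ereal" where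
  "growth m n p \<pi> x = expect (outcome_law m p) (\<lambda>I. elog (wealth m n \<pi> x I))"

definition V_par ::
  "nat \<Rightarrow> (nat \<Rightarrow> nat) \<Rightarrow> (nat \<Rightarrow> nat pmf) \<Rightarrow> (nat \<Rightarrow> nat \<Rightarrow> real) \<Rightarrow> ereal" where
  "V_par m n p \<pi> = (SUP x\<in>{x. multibet_feasible m n x}. growth m n p \<pi> x)"

definition product_stake ::
  "nat \<Rightarrow> (nat \<Rightarrow> real) \<Rightarrow> (nat \<Rightarrow> nat \<Rightarrow> real) \<Rightarrow> (nat \<Rightarrow> nat) \<Rightarrow> real" where
  "product_stake m c s \<gamma> =
     (\<Prod>l\<in>{l\<in>{1..m}. \<gamma> l = 0}. c l) * (\<Prod>l\<in>{l\<in>{1..m}. \<gamma> l \<noteq> 0}. s l (\<gamma> l))"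

end

theory Submission
  imports Defs
begin

text \<open>
  A positive wealth profile \<open>W\<close> is log-optimal among competitors \<open>W'\<close> as soon as the expected
  ratio satisfies \<open>E[W' / W] \<le> 1\<close>: since \<open>ln t \<le> t - 1\<close>, this bound gives
  \<open>E[log W'] - E[log W] \<le> E[W' / W] - 1 \<le> 0\<close> (lemma \<open>expect_elog_mono_ratio\<close>).  For a single
  event the converse also holds: moving a little from an optimal portfolio towards a competitor
  cannot increase the objective, and the derivative of the objective in that direction is
  \<open>E[F' / F] - 1\<close> (lemma \<open>kelly_optimal_ratio_le_1\<close>).  Testing against pure cash and against
  a single stake gives the first-order conditions: each pure position of the event has ratio at
  most one.

  A ticket is a choice of one pure position, or leg, per event, and its payoff is the product of
  the payoffs of its legs.  The stakes of the product portfolio are products over the legs as well.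
  So summing over tickets and multiplying over events commute, the product portfolio has total
  stake \<open>\<Prod>l. (c l + \<Sum>i. s l i) = 1\<close>, and its wealth is \<open>\<Prod>l. F l (I l)\<close>.  By independence the
  expected ratio of a ticket payoff to this wealth is the product of the one-event ratios, hence at
  most one (lemma \<open>ticket_ratio_le_1\<close>).  A feasible portfolio is a convex combination of tickets,
  so its expected ratio is at most one too, which proves optimality.  The formula for the value is
  then the logarithm of the wealth product.
\<close>

section \<open>Logarithmic optimality through ratios\<close>

lemma expect_ereal:
  assumes "\<And>x. x \<in> set_pmf P \<Longrightarrow> f x = ereal (g x)"
  shows "expect P f = ereal (\<Sum>x\<in>set_pmf P. pmf P x * g x)"
proof -
  have "expect P f = (\<Sum>x\<in>set_pmf P. ereal (pmf P x * g x))"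
    unfolding expect_def by (rule sum.cong) (simp_all add: assms)
  then show ?thesis by simp
qed

lemma expect_mono:
  assumes "\<And>x. x \<in> set_pmf P \<Longrightarrow> f x \<le> g x"
  shows "expect P f \<le> expect P g"
  unfolding expect_def by (intro sum_mono ereal_mult_left_mono assms) auto

text \<open>
  By concavity \<open>ln\<close> lies below its tangent at \<open>v\<close>.  The tangent is finite at wealth zero, so
  competitors that may go bankrupt need no separate treatment.
\<close>

lemma elog_le_tangent:
  assumes "0 < v"
  shows "elog w \<le> ereal (ln v + (w / v - 1))"
proof (cases "0 < w")
  case True
  then have "ln (w / v) \<le> w / v - 1"
    using assms by (intro ln_le_minus_one) simp
  then show ?thesis
    using True assms by (simp add: elog_def ln_div)
qed (simp add: elog_def)

lemma expect_elog_mono_ratio: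
  assumes fin: "finite (set_pmf P)"
    and pos: "\<And>x. x \<in> set_pmf P \<Longrightarrow> 0 < W x"
    and ratio: "(\<Sum>x\<in>set_pmf P. pmf P x * (W' x / W x)) \<le> 1"
  shows "expect P (\<lambda>x. elog (W' x)) \<le> expect P (\<lambda>x. elog (W x))"
proof -
  have "expect P (\<lambda>x. elog (W' x)) \<le> expect P (\<lambda>x. ereal (ln (W x) + (W' x / W x - 1)))"
    by (intro expect_mono elog_le_tangent pos)
  also have "\<dots> = ereal (\<Sum>x\<in>set_pmf P. pmf P x * (ln (W x) + (W' x / W x - 1)))"
    by (rule expect_ereal) simp
  also have "(\<Sum>x\<in>set_pmf P. pmf P x * (ln (W x) + (W' x / W x - 1)))
      = (\<Sum>x\<in>set_pmf P. pmf P x * ln (W x)) + (\<Sum>x\<in>set_pmf P. pmf P x * (W' x / W x))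
        - (\<Sum>x\<in>set_pmf P. pmf P x)"
    by (simp add: distrib_left right_diff_distrib sum.distrib sum_subtractf)
  also have "\<dots> \<le> (\<Sum>x\<in>set_pmf P. pmf P x * ln (W x))"
    using ratio sum_pmf_eq_1[OF fin, of P] by simp
  also have "ereal (\<Sum>x\<in>set_pmf P. pmf P x * ln (W x)) = expect P (\<lambda>x. elog (W x))"
    by (rule expect_ereal[symmetric]) (simp add: elog_def pos)
  finally show ?thesis by simp
qed


section \<open>First-order conditions for one event\<close>

lemma kelly_objective_eq_ln:
  assumes "\<And>i. i \<in> A \<Longrightarrow> 0 < c + s i / r i"
  shows "kelly_objective A q r c s = ereal (\<Sum>i\<in>A. pmf q i * ln (c + s i / r i))"
proof -
  have "kelly_objective A q r c s = (\<Sum>i\<in>A. ereal (pmf q i * ln (c + s i / r i)))"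
    unfolding kelly_objective_def by (rule sum.cong) (simp_all add: elog_def assms)
  then show ?thesis by simp
qed

lemma kelly_feasible_convex:
  assumes "kelly_feasible A c s" "kelly_feasible A c' s'" "0 \<le> t" "t \<le> 1"
  shows "kelly_feasible A (c + t * (c' - c)) (\<lambda>i. s i + t * (s' i - s i))"
proof -
  have eq: "u + t * (u' - u) = (1 - t) * u + t * u'" for u u' :: real
    by (simp add: algebra_simps)
  have "(1 - t) * c + t * c' + (\<Sum>i\<in>A. (1 - t) * s i + t * s' i)
      = (1 - t) * (c + sum s A) + t * (c' + sum s' A)"
    by (simp add: sum.distrib sum_distrib_left distrib_left)
  also have "\<dots> = 1" using assms by (simp add: kelly_feasible_def)
  finally show ?thesis
    using assms unfolding kelly_feasible_def eq by auto
qed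

text \<open>
  The derivative at \<open>t = 0\<close> of the objective along the segment from the optimum to a competitor
  is the left-hand side below minus one.  If it were positive, a short move would improve the
  optimum.
\<close>

lemma kelly_optimal_ratio_le_1:
  assumes opt: "kelly_optimal A q r c s"
    and fin: "finite A" and supp: "set_pmf q = A"
    and pos: "\<And>i. i \<in> A \<Longrightarrow> 0 < c + s i / r i"
    and r: "\<And>i. i \<in> A \<Longrightarrow> 0 < r i"
    and feas': "kelly_feasible A c' s'"
  shows "(\<Sum>i\<in>A. pmf q i * ((c' + s' i / r i) / (c + s i / r i))) \<le> 1"
proof (rule ccontr)
  define F where "F i = c + s i / r i" for i
  define F' where "F' i = c' + s' i / r i" for i
  define g where "g t = (\<Sum>i\<in>A. pmf q i * ln (F i + t * (F' i - F i)))" for t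
  assume "\<not> (\<Sum>i\<in>A. pmf q i * ((c' + s' i / r i) / (c + s i / r i))) \<le> 1"
  then have gt: "(\<Sum>i\<in>A. pmf q i * (F' i / F i)) > 1" by (simp add: F_def F'_def)
  have Fpos: "0 < F i" if "i \<in> A" for i using pos[OF that] by (simp add: F_def)
  have F'nn: "0 \<le> F' i" if "i \<in> A" for i
    using feas' r[OF that] that by (simp add: F'_def kelly_feasible_def)
  have "(g has_real_derivative (\<Sum>i\<in>A. pmf q i * ((F' i - F i) / F i))) (at 0)"
    unfolding g_def by (auto intro!: derivative_eq_intros sum.cong dest: Fpos)
  moreover have "(\<Sum>i\<in>A. pmf q i * ((F' i - F i) / F i))
      = (\<Sum>i\<in>A. pmf q i * (F' i / F i)) - (\<Sum>i\<in>A. pmf q i)"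
    unfolding sum_subtractf[symmetric]
  proof (rule sum.cong)
    fix i assume "i \<in> A"
    from Fpos[OF this] show "pmf q i * ((F' i - F i) / F i) = pmf q i * (F' i / F i) - pmf q i"
      by (simp add: field_simps)
  qed simp
  moreover have "(\<Sum>i\<in>A. pmf q i) = 1" using fin supp by (simp add: sum_pmf_eq_1)
  ultimately have "(g has_real_derivative (\<Sum>i\<in>A. pmf q i * (F' i / F i)) - 1) (at 0)" by simp
  from has_real_derivative_pos_inc_right[OF this] gt
  obtain d where d: "0 < d" "\<And>h. 0 < h \<Longrightarrow> h < d \<Longrightarrow> g 0 < g h" by auto
  \<comment> \<open>Staying below one keeps a positive share of \<open>F\<close>, so the mixture is positive even where
    the competitor has wealth zero.\<close>
  define t where "t = min (d / 2) (1 / 2)"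
  have t: "0 < t" "t < d" "t < 1" using d(1) by (auto simp: t_def)
  have Ft: "c + t * (c' - c) + (s i + t * (s' i - s i)) / r i = F i + t * (F' i - F i)" for i
    by (simp add: F_def F'_def field_simps add_divide_distrib diff_divide_distrib)
  have Ft_pos: "0 < F i + t * (F' i - F i)" if "i \<in> A" for i
  proof -
    have "0 < (1 - t) * F i + t * F' i"
      using Fpos[OF that] F'nn[OF that] t by (intro add_pos_nonneg) auto
    then show ?thesis by (simp add: algebra_simps)
  qed
  have "kelly_objective A q r (c + t * (c' - c)) (\<lambda>i. s i + t * (s' i - s i)) = ereal (g t)"
    by (subst kelly_objective_eq_ln) (simp_all add: Ft Ft_pos g_def)
  moreover have "kelly_objective A q r c s = ereal (g 0)"
    by (subst kelly_objective_eq_ln) (simp_all add: pos g_def F_def)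
  moreover have "kelly_feasible A (c + t * (c' - c)) (\<lambda>i. s i + t * (s' i - s i))"
    using opt feas' t by (intro kelly_feasible_convex) (auto simp: kelly_optimal_def)
  ultimately have "g t \<le> g 0" using opt unfolding kelly_optimal_def by (metis ereal_less_eq(3))
  with d(2)[OF t(1,2)] show False by simp
qed


section \<open>Tickets as products of legs\<close>

text \<open>
  A leg is the part of a ticket that concerns one event.  Its value \<open>0\<close> stands for cash, which
  pays one in every outcome.
\<close>

definition leg_stake :: "real \<Rightarrow> (nat \<Rightarrow> real) \<Rightarrow> nat \<Rightarrow> real" where
  "leg_stake c s j = (if j = 0 then c else s j)"

definition leg_payoff :: "(nat \<Rightarrow> real) \<Rightarrow> nat \<Rightarrow> nat \<Rightarrow> real" where
  "leg_payoff r j i = (if j = 0 then 1 else if j = i then 1 / r j else 0)"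

lemma finite_outcomes [simp]: "finite (outcomes n l)"
  by (simp add: outcomes_def)

lemma zero_notin_outcomes [simp]: "0 \<notin> outcomes n l"
  by (simp add: outcomes_def)

lemma finite_tickets: "finite (tickets m n)"
  unfolding tickets_def by (intro finite_PiE) auto

lemma product_stake_eq_prod_legs:
  "product_stake m c s \<gamma> = (\<Prod>l\<in>{1..m}. leg_stake (c l) (s l) (\<gamma> l))"
  unfolding product_stake_def leg_stake_def by (simp add: prod.If_cases Int_def)

lemma ticket_payoff_eq_prod_legs:
  "(if ticket_wins m \<gamma> I then 1 / ticket_price m \<pi> \<gamma> else 0)
    = (\<Prod>l\<in>{1..m}. leg_payoff (\<pi> l) (\<gamma> l) (I l))"
proof (cases "ticket_wins m \<gamma> I")
  case True
  have "(\<Prod>l\<in>{1..m}. leg_payoff (\<pi> l) (\<gamma> l) (I l))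
      = (\<Prod>l\<in>{1..m}. if \<gamma> l \<noteq> 0 then 1 / \<pi> l (\<gamma> l) else 1)"
    using True by (intro prod.cong) (auto simp: ticket_wins_def leg_payoff_def)
  also have "\<dots> = (\<Prod>l\<in>{l\<in>{1..m}. \<gamma> l \<noteq> 0}. 1 / \<pi> l (\<gamma> l))"
    by (rule prod.inter_filter[symmetric]) simp
  also have "\<dots> = 1 / ticket_price m \<pi> \<gamma>"
    by (simp add: ticket_price_def prod_dividef)
  finally show ?thesis using True by simp
next
  case False
  then obtain l where "l \<in> {1..m}" "\<gamma> l \<noteq> 0" "\<gamma> l \<noteq> I l" by (auto simp: ticket_wins_def)
  then have "(\<Prod>l\<in>{1..m}. leg_payoff (\<pi> l) (\<gamma> l) (I l)) = 0"
    by (intro prod_zero) (auto simp: leg_payoff_def)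
  with False show ?thesis by simp
qed

lemma wealth_eq_sum_prod_legs:
  "wealth m n \<pi> x I = (\<Sum>\<gamma>\<in>tickets m n. x \<gamma> * (\<Prod>l\<in>{1..m}. leg_payoff (\<pi> l) (\<gamma> l) (I l)))"
  unfolding wealth_def sum.inter_filter[OF finite_tickets] ticket_payoff_eq_prod_legs[symmetric]
  by (intro sum.cong) auto

text \<open>Choosing a ticket means choosing one leg for each event independently.\<close>

lemma sum_tickets_prod_legs:
  fixes f :: "nat \<Rightarrow> nat \<Rightarrow> real"
  shows "(\<Sum>\<gamma>\<in>tickets m n. \<Prod>l\<in>{1..m}. f l (\<gamma> l))
    = (\<Prod>l\<in>{1..m}. f l 0 + (\<Sum>j\<in>outcomes n l. f l j))"
proof -
  have "(\<Sum>\<gamma>\<in>tickets m n. \<Prod>l\<in>{1..m}. f l (\<gamma> l))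
      = (\<Prod>l\<in>{1..m}. \<Sum>j\<in>{0} \<union> outcomes n l. f l j)"
    unfolding tickets_def by (rule prod_sum_PiE[symmetric]) auto
  then show ?thesis by simp
qed

lemma product_stake_feasible:
  assumes "\<And>l. l \<in> {1..m} \<Longrightarrow> kelly_feasible (outcomes n l) (c l) (s l)"
  shows "multibet_feasible m n (product_stake m c s)"
  unfolding multibet_feasible_def
proof
  show "\<forall>\<gamma>\<in>tickets m n. 0 \<le> product_stake m c s \<gamma>"
    unfolding product_stake_eq_prod_legs
  proof (intro ballI prod_nonneg)
    fix \<gamma> l assume "\<gamma> \<in> tickets m n" and l: "l \<in> {1..m}"
    then have "\<gamma> l \<in> {0} \<union> outcomes n l" unfolding tickets_def by (rule PiE_mem)
    with assms[OF l] show "0 \<le> leg_stake (c l) (s l) (\<gamma> l)"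
      by (auto simp: leg_stake_def kelly_feasible_def)
  qed
  have "(\<Sum>\<gamma>\<in>tickets m n. product_stake m c s \<gamma>)
      = (\<Prod>l\<in>{1..m}. leg_stake (c l) (s l) 0 + (\<Sum>j\<in>outcomes n l. leg_stake (c l) (s l) j))"
    unfolding product_stake_eq_prod_legs by (rule sum_tickets_prod_legs)
  also have "\<dots> = 1"
  proof (rule prod.neutral, rule ballI)
    fix l assume "l \<in> {1..m}"
    moreover have "(\<Sum>j\<in>outcomes n l. leg_stake (c l) (s l) j) = (\<Sum>j\<in>outcomes n l. s l j)"
      by (intro sum.cong) (auto simp: leg_stake_def outcomes_def)
    ultimately show "leg_stake (c l) (s l) 0 + (\<Sum>j\<in>outcomes n l. leg_stake (c l) (s l) j) = 1"
      using assms by (simp add: leg_stake_def kelly_feasible_def)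
  qed
  finally show "(\<Sum>\<gamma>\<in>tickets m n. product_stake m c s \<gamma>) = 1" .
qed

text \<open>
  Summing stake times payoff over the legs of one event leaves the cash and the one stake on the
  realized outcome.
\<close>

lemma wealth_product_stake:
  assumes I: "\<And>l. l \<in> {1..m} \<Longrightarrow> I l \<in> outcomes n l"
  shows "wealth m n \<pi> (product_stake m c s) I = (\<Prod>l\<in>{1..m}. c l + s l (I l) / \<pi> l (I l))"
proof -
  define f where "f l j = leg_stake (c l) (s l) j * leg_payoff (\<pi> l) j (I l)" for l j
  have "wealth m n \<pi> (product_stake m c s) I = (\<Sum>\<gamma>\<in>tickets m n. \<Prod>l\<in>{1..m}. f l (\<gamma> l))"
    unfolding wealth_eq_sum_prod_legs product_stake_eq_prod_legs f_def
    by (simp add: prod.distrib)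
  also have "\<dots> = (\<Prod>l\<in>{1..m}. f l 0 + (\<Sum>j\<in>outcomes n l. f l j))"
    by (rule sum_tickets_prod_legs)
  also have "\<dots> = (\<Prod>l\<in>{1..m}. c l + s l (I l) / \<pi> l (I l))"
  proof (rule prod.cong)
    fix l assume l: "l \<in> {1..m}"
    have "(\<Sum>j\<in>outcomes n l. f l j)
        = (\<Sum>j\<in>outcomes n l. if j = I l then s l j / \<pi> l j else 0)"
      by (intro sum.cong) (auto simp: f_def leg_stake_def leg_payoff_def outcomes_def)
    also have "\<dots> = s l (I l) / \<pi> l (I l)" using I[OF l] by simp
    finally show "f l 0 + (\<Sum>j\<in>outcomes n l. f l j) = c l + s l (I l) / \<pi> l (I l)"
      by (simp add: f_def leg_stake_def leg_payoff_def)
  qed simp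
  finally show ?thesis .
qed


section \<open>Expected ratios of tickets\<close>

text \<open>
  A leg is itself a feasible one-event portfolio: all in cash, or all on one outcome.
\<close>

lemma leg_ratio_le_1:
  assumes opt: "kelly_optimal A q r c s"
    and fin: "finite A" and supp: "set_pmf q = A" and zero: "0 \<notin> A"
    and pos: "\<And>i. i \<in> A \<Longrightarrow> 0 < c + s i / r i"
    and r: "\<And>i. i \<in> A \<Longrightarrow> 0 < r i"
    and j: "j \<in> {0} \<union> A"
  shows "(\<Sum>i\<in>A. pmf q i * (leg_payoff r j i / (c + s i / r i))) \<le> 1"
proof -
  define c' :: real where "c' = (if j = 0 then 1 else 0)"
  define s' :: "nat \<Rightarrow> real" where "s' i = (if i = j then 1 - c' else 0)" for i
  have "kelly_feasible A c' s'"
    using j fin zero by (auto simp: kelly_feasible_def c'_def s'_def)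
  from kelly_optimal_ratio_le_1[OF opt fin supp pos r this]
  have "(\<Sum>i\<in>A. pmf q i * ((c' + s' i / r i) / (c + s i / r i))) \<le> 1" .
  moreover have "c' + s' i / r i = leg_payoff r j i" for i
    by (auto simp: c'_def s'_def leg_payoff_def)
  ultimately show ?thesis by simp
qed

lemma set_outcome_law:
  assumes "\<And>l. l \<in> {1..m} \<Longrightarrow> set_pmf (p l) = outcomes n l"
  shows "set_pmf (outcome_law m p) = PiE_dflt {1..m} 0 (outcomes n)"
  unfolding outcome_law_def using assms by (auto simp: set_Pi_pmf PiE_dflt_def)

lemma finite_set_outcome_law:
  assumes "\<And>l. l \<in> {1..m} \<Longrightarrow> set_pmf (p l) = outcomes n l"
  shows "finite (set_pmf (outcome_law m p))"
  by (subst set_outcome_law[OF assms]) (auto intro!: finite_PiE_dflt)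

lemma sum_outcome_law_prod:
  fixes h :: "nat \<Rightarrow> nat \<Rightarrow> real"
  assumes supp: "\<And>l. l \<in> {1..m} \<Longrightarrow> set_pmf (p l) = outcomes n l"
    and nonneg: "\<And>l i. l \<in> {1..m} \<Longrightarrow> i \<in> outcomes n l \<Longrightarrow> 0 \<le> h l i"
  shows "(\<Sum>I\<in>set_pmf (outcome_law m p). pmf (outcome_law m p) I * (\<Prod>l\<in>{1..m}. h l (I l)))
    = (\<Prod>l\<in>{1..m}. \<Sum>i\<in>outcomes n l. pmf (p l) i * h l i)"
proof -
  have "(\<Sum>I\<in>set_pmf (outcome_law m p). pmf (outcome_law m p) I * (\<Prod>l\<in>{1..m}. h l (I l)))
      = measure_pmf.expectation (outcome_law m p) (\<lambda>I. \<Prod>l\<in>{1..m}. h l (I l))"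
    by (subst integral_measure_pmf_real[OF finite_set_outcome_law[OF supp]])
      (auto simp: mult.commute)
  also have "\<dots> = (\<Prod>l\<in>{1..m}. measure_pmf.expectation (p l) (h l))"
    unfolding outcome_law_def
    by (intro expectation_prod_Pi_pmf) (auto simp: supp nonneg intro!: integrable_measure_pmf_finite)
  also have "\<dots> = (\<Prod>l\<in>{1..m}. \<Sum>i\<in>outcomes n l. pmf (p l) i * h l i)"
  proof (rule prod.cong)
    fix l assume "l \<in> {1..m}"
    then show "measure_pmf.expectation (p l) (h l) = (\<Sum>i\<in>outcomes n l. pmf (p l) i * h l i)"
      by (subst integral_measure_pmf_real[of "outcomes n l"]) (auto simp: supp mult.commute)
  qed simp
  finally show ?thesis .
qed

text \<open>By independence, the ratio of a ticket is the product of the ratios of its legs.\<close>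

lemma ticket_ratio_le_1:
  assumes supp: "\<And>l. l \<in> {1..m} \<Longrightarrow> set_pmf (p l) = outcomes n l"
    and r: "\<And>l i. l \<in> {1..m} \<Longrightarrow> i \<in> outcomes n l \<Longrightarrow> 0 < \<pi> l i"
    and opt: "\<And>l. l \<in> {1..m} \<Longrightarrow> kelly_optimal (outcomes n l) (p l) (\<pi> l) (c l) (s l)"
    and pos: "\<And>l i. l \<in> {1..m} \<Longrightarrow> i \<in> outcomes n l \<Longrightarrow> 0 < c l + s l i / \<pi> l i"
    and \<gamma>: "\<gamma> \<in> tickets m n"
  shows "(\<Sum>I\<in>set_pmf (outcome_law m p). pmf (outcome_law m p) I *
      (\<Prod>l\<in>{1..m}. leg_payoff (\<pi> l) (\<gamma> l) (I l) / (c l + s l (I l) / \<pi> l (I l)))) \<le> 1"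
proof -
  define h where "h l i = leg_payoff (\<pi> l) (\<gamma> l) i / (c l + s l i / \<pi> l i)" for l i
  have nonneg: "0 \<le> h l i" if "l \<in> {1..m}" "i \<in> outcomes n l" for l i
    using pos[OF that] r[OF that] by (simp add: h_def leg_payoff_def)
  have leg: "(\<Sum>i\<in>outcomes n l. pmf (p l) i * h l i) \<le> 1" if l: "l \<in> {1..m}" for l
  proof -
    have "\<gamma> l \<in> {0} \<union> outcomes n l" using \<gamma> l unfolding tickets_def by (rule PiE_mem)
    then show ?thesis
      unfolding h_def using l by (intro leg_ratio_le_1 opt supp pos r) auto
  qed
  have "(\<Sum>I\<in>set_pmf (outcome_law m p). pmf (outcome_law m p) I * (\<Prod>l\<in>{1..m}. h l (I l)))
      = (\<Prod>l\<in>{1..m}. \<Sum>i\<in>outcomes n l. pmf (p l) i * h l i)"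
    by (rule sum_outcome_law_prod) (simp_all add: supp nonneg)
  also have "\<dots> \<le> 1"
    by (intro prod_le_1 conjI sum_nonneg mult_nonneg_nonneg leg nonneg) simp_all
  finally show ?thesis by (simp add: h_def)
qed


section \<open>Optimality of the product portfolio\<close>

theorem theorem3p1:
  fixes m :: nat
    and n :: "nat \<Rightarrow> nat"
    and p :: "nat \<Rightarrow> nat pmf"
    and \<pi> :: "nat \<Rightarrow> nat \<Rightarrow> real"
    and c :: "nat \<Rightarrow> real"
    and s :: "nat \<Rightarrow> nat \<Rightarrow> real"
    and F :: "nat \<Rightarrow> nat \<Rightarrow> real"
    and xstar :: "(nat \<Rightarrow> nat) \<Rightarrow> real"
  assumes "1 \<le> m"
    and "\<And>l. l \<in> {1..m} \<Longrightarrow> set_pmf (p l) = outcomes n l"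
    and "\<And>l i. l \<in> {1..m} \<Longrightarrow> i \<in> outcomes n l \<Longrightarrow> 0 < \<pi> l i"
    and "\<And>l. l \<in> {1..m} \<Longrightarrow> kelly_unique_optimal (outcomes n l) (p l) (\<pi> l) (c l) (s l)"
    and "\<And>l. l \<in> {1..m} \<Longrightarrow> 0 < c l"
    and "\<And>l i. l \<in> {1..m} \<Longrightarrow> i \<in> outcomes n l \<Longrightarrow> F l i = c l + s l i / \<pi> l i"
    and "\<And>\<gamma>. \<gamma> \<in> tickets m n \<Longrightarrow> xstar \<gamma> = product_stake m c s \<gamma>"
  shows "multibet_feasible m n xstar \<and>
    growth m n p \<pi> xstar = V_par m n p \<pi> \<and>
    (\<forall>I \<in> (\<Pi> l\<in>{1..m}. outcomes n l). wealth m n \<pi> xstar I = (\<Prod>l\<in>{1..m}. F l (I l))) \<and>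
    V_par m n p \<pi> = (\<Sum>l\<in>{1..m}. expect (outcome_law m p) (\<lambda>I. elog (F l (I l))))"
proof -
  note supp = assms(2) and price_pos = assms(3) and cash_pos = assms(5)
    and F_eq = assms(6) and xstar_eq = assms(7)
  let ?P = "outcome_law m p"
  have opt: "kelly_optimal (outcomes n l) (p l) (\<pi> l) (c l) (s l)" if "l \<in> {1..m}" for l
    using assms(4)[OF that] by (simp add: kelly_unique_optimal_def)
  have feas: "kelly_feasible (outcomes n l) (c l) (s l)" if "l \<in> {1..m}" for l
    using opt[OF that] by (simp add: kelly_optimal_def)
  have pos: "0 < c l + s l i / \<pi> l i" if "l \<in> {1..m}" "i \<in> outcomes n l" for l i
    using cash_pos[OF that(1)] feas[OF that(1)] price_pos[OF that] that(2)
    by (intro add_pos_nonneg) (auto simp: kelly_feasible_def)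
  have F_pos: "0 < F l i" if "l \<in> {1..m}" "i \<in> outcomes n l" for l i
    using pos[OF that] F_eq[OF that] by simp
  have feasible: "multibet_feasible m n xstar"
    using product_stake_feasible[of m n c s, OF feas] xstar_eq
    by (simp add: multibet_feasible_def)
  have wealth_xstar: "wealth m n \<pi> xstar I = (\<Prod>l\<in>{1..m}. F l (I l))"
    if I: "\<And>l. l \<in> {1..m} \<Longrightarrow> I l \<in> outcomes n l" for I
  proof -
    have "wealth m n \<pi> xstar I = wealth m n \<pi> (product_stake m c s) I"
      unfolding wealth_def by (intro sum.cong) (auto simp: xstar_eq)
    also have "\<dots> = (\<Prod>l\<in>{1..m}. c l + s l (I l) / \<pi> l (I l))"
      using I by (rule wealth_product_stake)
    also have "\<dots> = (\<Prod>l\<in>{1..m}. F l (I l))"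
      by (intro prod.cong) (auto simp: F_eq I)
    finally show ?thesis .
  qed
  have fin: "finite (set_pmf ?P)" by (rule finite_set_outcome_law[OF supp])
  have outcome: "I l \<in> outcomes n l" if "I \<in> set_pmf ?P" "l \<in> {1..m}" for I l
    using that set_outcome_law[OF supp] by (auto simp: PiE_dflt_def)
  have wealth_law: "wealth m n \<pi> xstar I = (\<Prod>l\<in>{1..m}. F l (I l))" if "I \<in> set_pmf ?P" for I
    by (rule wealth_xstar) (rule outcome[OF that])
  have wealth_pos: "0 < wealth m n \<pi> xstar I" if "I \<in> set_pmf ?P" for I
    unfolding wealth_law[OF that] by (intro prod_pos ballI F_pos outcome[OF that])

  have optimal: "growth m n p \<pi> x \<le> growth m n p \<pi> xstar" if x: "multibet_feasible m n x" for x
    unfolding growth_def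
  proof (rule expect_elog_mono_ratio[OF fin wealth_pos])
    define R where "R \<gamma> I = (\<Prod>l\<in>{1..m}.
      leg_payoff (\<pi> l) (\<gamma> l) (I l) / (c l + s l (I l) / \<pi> l (I l)))" for \<gamma> I
    have ratio: "wealth m n \<pi> x I / wealth m n \<pi> xstar I = (\<Sum>\<gamma>\<in>tickets m n. x \<gamma> * R \<gamma> I)"
      if I: "I \<in> set_pmf ?P" for I
    proof -
      have "wealth m n \<pi> xstar I = (\<Prod>l\<in>{1..m}. c l + s l (I l) / \<pi> l (I l))"
        unfolding wealth_law[OF I] by (intro prod.cong) (auto simp: F_eq outcome[OF I])
      then show ?thesis
        unfolding wealth_eq_sum_prod_legs[of m n \<pi> x I] R_def
        by (simp add: sum_divide_distrib prod_dividef)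
    qed
    \<comment> \<open>The stakes of \<open>x\<close> are weights, so its expected ratio is the weighted average of the
      expected ratios \<open>R \<gamma>\<close> of the single tickets.\<close>
    have "(\<Sum>I\<in>set_pmf ?P. pmf ?P I * (wealth m n \<pi> x I / wealth m n \<pi> xstar I))
        = (\<Sum>I\<in>set_pmf ?P. \<Sum>\<gamma>\<in>tickets m n. x \<gamma> * (pmf ?P I * R \<gamma> I))"
      by (intro sum.cong refl) (simp add: ratio sum_distrib_left mult_ac)
    also have "\<dots> = (\<Sum>\<gamma>\<in>tickets m n. x \<gamma> * (\<Sum>I\<in>set_pmf ?P. pmf ?P I * R \<gamma> I))"
      by (subst sum.swap) (simp add: sum_distrib_left)
    also have "\<dots> \<le> (\<Sum>\<gamma>\<in>tickets m n. x \<gamma> * 1)"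
    proof (intro sum_mono mult_left_mono)
      fix \<gamma> assume \<gamma>: "\<gamma> \<in> tickets m n"
      show "(\<Sum>I\<in>set_pmf ?P. pmf ?P I * R \<gamma> I) \<le> 1"
        unfolding R_def using supp price_pos opt pos \<gamma> by (rule ticket_ratio_le_1)
      show "0 \<le> x \<gamma>" using x \<gamma> by (simp add: multibet_feasible_def)
    qed
    also have "\<dots> = 1" using x by (simp add: multibet_feasible_def)
    finally show "(\<Sum>I\<in>set_pmf ?P. pmf ?P I * (wealth m n \<pi> x I / wealth m n \<pi> xstar I)) \<le> 1" .
  qed
  have attained: "growth m n p \<pi> xstar = V_par m n p \<pi>"
    unfolding V_par_def using feasible optimal
    by (intro antisym SUP_upper SUP_least) auto

  have "growth m n p \<pi> xstar
      = ereal (\<Sum>I\<in>set_pmf ?P. pmf ?P I * (\<Sum>l\<in>{1..m}. ln (F l (I l))))"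
    unfolding growth_def
  proof (rule expect_ereal)
    fix I assume I: "I \<in> set_pmf ?P"
    have "ln (wealth m n \<pi> xstar I) = (\<Sum>l\<in>{1..m}. ln (F l (I l)))"
      unfolding wealth_law[OF I]
      by (intro ln_prod) (use F_pos outcome[OF I] in force)+
    then show "elog (wealth m n \<pi> xstar I) = ereal (\<Sum>l\<in>{1..m}. ln (F l (I l)))"
      using wealth_pos[OF I] by (simp add: elog_def)
  qed
  also have "(\<Sum>I\<in>set_pmf ?P. pmf ?P I * (\<Sum>l\<in>{1..m}. ln (F l (I l))))
      = (\<Sum>l\<in>{1..m}. \<Sum>I\<in>set_pmf ?P. pmf ?P I * ln (F l (I l)))"
    unfolding sum_distrib_left by (rule sum.swap)
  also have "ereal \<dots> = (\<Sum>l\<in>{1..m}. ereal (\<Sum>I\<in>set_pmf ?P. pmf ?P I * ln (F l (I l))))"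
    by simp
  also have "\<dots> = (\<Sum>l\<in>{1..m}. expect ?P (\<lambda>I. elog (F l (I l))))"
    by (intro sum.cong refl expect_ereal[symmetric]) (simp add: elog_def F_pos outcome)
  finally have "V_par m n p \<pi> = (\<Sum>l\<in>{1..m}. expect ?P (\<lambda>I. elog (F l (I l))))"
    using attained by simp
  moreover have "\<forall>I \<in> (\<Pi> l\<in>{1..m}. outcomes n l).
      wealth m n \<pi> xstar I = (\<Prod>l\<in>{1..m}. F l (I l))"
    by (intro ballI wealth_xstar) (rule Pi_mem)
  ultimately show ?thesis using feasible attained by blast
qed

end
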